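(* Let $\frac23<p\le2$, $s_p=\frac1p-\frac12$, $0<r<1$ and $s_p<s<1$, and let $q$ be the conjugate exponent of $p$, i.e. $\frac1q=1-\frac1p$. Let $\rho\in[0,1]$ satisfy $r+\frac1q\le\rho$, and let $\sigma:\mathbb{Z}\to\mathbb{C}$ satisfy the $\rho$-condition: there is $C>0$ such that $|\sigma(\xi)|\le C|\xi|^{-\rho}$ for all $\xi\in\mathbb{Z}\setminus\{0\}$. Then the Fourier multiplier $\mathrm{Op}(\sigma)$ is bounded from $B^{s}_{\infty,\infty}(\mathbb{T})$ into $B^{r}_{\infty,\infty}(\mathbb{T})$.
   Context: $\mathbb{T}=[0,2\pi)$ is the one-dimensional torus with normalized Haar measure $dx$; $\widehat f(\xi)=\int_{\mathbb{T}}e^{-ix\xi}f(x)\,dx$ for $\xi\in\mathbb{Z}$, so that $f(x)=\sum_{\xi\in\mathbb{Z}}e^{ix\xi}\widehat f(\xi)$ for $f\in C^\infty(\mathbb{T})$. For $\sigma:\mathbb{Z}\to\mathbb{C}$, the Fourier multiplier is $\mathrm{Op}(\sigma)f(x)=\sum_{\xi\in\mathbb{Z}}e^{ix\xi}\sigma(\xi)\widehat f(\xi)$. The Besov space $B^r_{\infty,\infty}(\mathbb{T})$ is defined by $$\|f\|_{B^r_{\infty,\infty}}=\sup_{m\ge 0}2^{mr}\Big\|\sum_{2^m\le|\xi|<2^{m+1}}e^{ix\xi}\widehat f(\xi)\Big\|_{L^\infty(\mathbb{T})}.$$ For $0<r<1$ the paper identifies $B^r_{\infty,\infty}(\mathbb{T})$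 with the Hölder space $\Lambda^r(\mathbb{T})$ with norm $\|f\|_{\Lambda^r}=\sup_{x,\,y\neq 0}\frac{|f(x-y)-f(x)|}{|y|^r}+\sup_x|f(x)|$. Bounded from $X$ into $Y$ means: there is $C>0$ with $\|\mathrm{Op}(\sigma)f\|_Y\le C\|f\|_X$ for all $f\in C^\infty(\mathbb{T})$. *)

theory Defs
  imports "HOL-Probability.Probability"
begin

text \<open>
  Functions on the torus are functions on the real line, restricted to the fundamental
  domain \<open>{0..<2*pi}\<close> by the measure, and required to be \<open>2*pi\<close>-periodic where smoothness matters.
\<close>

definition torus :: "real measure" where
  "torus = uniform_measure lborel {0..<2 * pi}"

definition smooth_torus :: "(real \<Rightarrow> complex) set" where
  "smooth_torus = {f. (\<forall>x. f (x + 2 * pi) = f x) \<and>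
     (\<exists>D. D 0 = f \<and> (\<forall>n x. (D n has_vector_derivative D (Suc n) x) (at x)))}"

definition fourier_coeff :: "(real \<Rightarrow> complex) \<Rightarrow> int \<Rightarrow> complex" where
  "fourier_coeff f \<xi> = (LINT x|torus. cis (- (x * of_int \<xi>)) * f x)"

definition Op :: "(int \<Rightarrow> complex) \<Rightarrow> (real \<Rightarrow> complex) \<Rightarrow> real \<Rightarrow> complex" where
  "Op \<sigma> f x = (\<Sum>\<^sub>\<infinity>\<xi>\<in>UNIV. cis (x * of_int \<xi>) * \<sigma> \<xi> * fourier_coeff f \<xi>)"

definition Linf_norm :: "(real \<Rightarrow> complex) \<Rightarrow> ennreal" where
  "Linf_norm f = esssup torus (\<lambda>x. ennreal (norm (f x)))"

definition dyadic_block :: "nat \<Rightarrow> (real \<Rightarrow> complex) \<Rightarrow> real \<Rightarrow> complex" where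
  "dyadic_block m f x =
     (\<Sum>\<xi> | 2 ^ m \<le> \<bar>\<xi>\<bar> \<and> \<bar>\<xi>\<bar> < 2 ^ (m + 1). cis (x * of_int \<xi>) * fourier_coeff f \<xi>)"

text \<open>
  The Besov norm with both lower indices infinite. The supremum is taken in \<open>ennreal\<close>, so it is
  infinite outside the space. The zero frequency lies in no block \<open>m \<ge> 0\<close>, so constants
  have norm zero.
\<close>

definition besov_norm :: "real \<Rightarrow> (real \<Rightarrow> complex) \<Rightarrow> ennreal" where
  "besov_norm r f = (SUP m. ennreal (2 powr (real m * r)) * Linf_norm (dyadic_block m f))"

definition rho_condition :: "real \<Rightarrow> (int \<Rightarrow> complex) \<Rightarrow> bool" where
  "rho_condition \<rho> \<sigma> \<longleftrightarrow>
     (\<exists>C>0. \<forall>\<xi>. \<xi> \<noteq> 0 \<longrightarrow> norm (\<sigma> \<xi>) \<le> C * real_of_int \<bar>\<xi>\<bar> powr (- \<rho>))"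

definition bounded_from_into ::
  "((real \<Rightarrow> complex) \<Rightarrow> ennreal) \<Rightarrow> ((real \<Rightarrow> complex) \<Rightarrow> ennreal) \<Rightarrow>
   ((real \<Rightarrow> complex) \<Rightarrow> real \<Rightarrow> complex) \<Rightarrow> bool" where
  "bounded_from_into X Y T \<longleftrightarrow>
     (\<exists>C::real. C > 0 \<and> (\<forall>f\<in>smooth_torus. Y (T f) \<le> ennreal C * X f))"

end

theory Submission
  imports Defs
begin

text \<open>
  A multiplier acts on each dyadic block separately, so it suffices to bound one block and to see
  that the bounds agree across scales. The block of index \<open>m\<close> has at most \<open>2 * 2 ^ m\<close> frequencies,
  and there \<open>\<sigma>\<close> has size at most a constant times \<open>2 powr (- m * \<rho>)\<close>. The new block is at most the
  \<open>\<ell>\<^sup>1\<close> norm of its coefficients; Cauchy--Schwarz turns that into their \<open>\<ell>\<^sup>2\<close> norm at the price of the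
  square root of the number of frequencies, and by Parseval the \<open>\<ell>\<^sup>2\<close> norm is at most the supremum of
  the old block (\<open>Linf_norm_multiplier_trig_sum_le\<close>). A block thus grows by a factor of order
  \<open>2 powr (m * (1 / 2 - \<rho>))\<close>, and the weights of the two Besov norms absorb it exactly when
  \<open>r + 1 / 2 - \<rho> \<le> s\<close> (\<open>Op_bounded_besov\<close>). The hypotheses give
  \<open>r + 1 / 2 - \<rho> \<le> 1 / 2 - 1 / q = 1 / p - 1 / 2 = s\<^sub>p < s\<close>.

  The one analytic point is that the Fourier coefficients of \<open>Op \<sigma> f\<close> really are \<open>\<sigma>\<close> times those of
  \<open>f\<close> (\<open>fourier_coeff_Op\<close>): \<open>Op \<sigma> f\<close> is defined pointwise by a series, which has to be
  integrated term by term. For this the coefficients of a smooth \<open>f\<close> must be absolutely summable, and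
  two integrations by parts bound them by a multiple of \<open>1 / n\<^sup>2\<close>.
\<close>

section \<open>Integration on the torus\<close>

lemma emeasure_circle: "emeasure lborel {0..<2 * pi} = ennreal (2 * pi)"
  by simp

lemma sets_torus [measurable_cong, simp]: "sets torus = sets borel"
  by (simp add: torus_def)

lemma measurable_torus_eq [simp]: "borel_measurable torus = borel_measurable borel"
  by (rule measurable_cong_sets) simp_all

interpretation torus: prob_space torus
  unfolding torus_def
  by (rule prob_space_uniform_measure) (auto simp: emeasure_circle ennreal_eq_0_iff not_le)

lemma torus_integral_lborel:
  fixes f :: "real \<Rightarrow> complex"
  assumes [measurable]: "f \<in> borel_measurable borel"
  shows "(LINT x|torus. f x) = (LINT x|lborel. indicator {0..2 * pi} x *\<^sub>R f x) / (2 * pi)"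
proof -
  have density: "torus = density lborel (\<lambda>x. ennreal (indicator {0..<2 * pi} x / (2 * pi)))"
    unfolding torus_def uniform_measure_def
    by (intro density_cong)
       (auto simp: divide_ennreal[of 1, simplified] split: split_indicator)
  have "(LINT x|torus. f x) =
      (LINT x|lborel. (indicator {0..<2 * pi} x / (2 * pi)) *\<^sub>R f x)"
    unfolding density by (subst integral_density) auto
  also have "\<dots> = (LINT x|lborel. (indicator {0..2 * pi} x *\<^sub>R f x) / (2 * pi))"
    by (intro integral_cong_AE)
       (use AE_lborel_singleton[of "2 * pi"] in \<open>auto split: split_indicator simp: scaleR_conv_of_real\<close>)
  also have "\<dots> = (LINT x|lborel. indicator {0..2 * pi} x *\<^sub>R f x) / (2 * pi)"
    by (rule integral_divide_zero)
  finally show ?thesis .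
qed

text \<open>
  This form of the fundamental theorem of calculus gives both the orthogonality of the characters
  and integration by parts without boundary terms.
\<close>

lemma torus_integral_derivative_periodic:
  fixes F F' :: "real \<Rightarrow> complex"
  assumes deriv: "\<And>x. (F has_vector_derivative F' x) (at x)"
    and cont: "continuous_on UNIV F'"
    and periodic: "F (2 * pi) = F 0"
  shows "(LINT x|torus. F' x) = 0"
proof -
  have [measurable]: "F' \<in> borel_measurable borel"
    using cont by (rule borel_measurable_continuous_onI)
  have "(LINT x|lborel. indicator {0..2 * pi} x *\<^sub>R F' x) = F (2 * pi) - F 0"
    by (rule integral_FTC_Icc)
       (auto intro: has_vector_derivative_at_within[OF deriv] continuous_on_subset[OF cont])
  then show ?thesis
    by (simp add: torus_integral_lborel periodic)
qed

section \<open>Trigonometric sums\<close>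

lemma cis_frequency_has_vector_derivative:
  "((\<lambda>x. cis (x * a)) has_vector_derivative (\<i> * of_real a * cis (x * a))) (at x)"
  unfolding has_vector_derivative_def
  by (rule derivative_eq_intros refl)+ (auto simp: scaleR_conv_of_real fun_eq_iff)

lemma integrable_torus_bounded:
  fixes f :: "real \<Rightarrow> complex"
  assumes "f \<in> borel_measurable borel" "\<And>x. norm (f x) \<le> B"
  shows "integrable torus f"
  by (rule torus.integrable_const_bound[of _ B]) (use assms in auto)

lemma measurable_cis_frequency [measurable]: "(\<lambda>x. cis (x * a)) \<in> borel_measurable borel"
  by (intro borel_measurable_continuous_onI continuous_intros)

lemma measurable_cis_frequency_uminus [measurable]:
  "(\<lambda>x. cis (- (x * a))) \<in> borel_measurable borel"
  by (intro borel_measurable_continuous_onI continuous_intros)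

lemma fourier_coeff_cis:
  "fourier_coeff (\<lambda>x. cis (x * of_int k)) n = (if k = n then 1 else 0)"
proof (cases "k = n")
  case True
  then show ?thesis
    by (simp add: fourier_coeff_def cis_mult torus.prob_space)
next
  case False
  \<comment> \<open>The product of the two characters is the character of frequency \<open>d\<close>; since \<open>d \<noteq> 0\<close>, it is,
    up to a nonzero factor, the derivative of a periodic function.\<close>
  define d where "d = k - n"
  have d: "of_int d \<noteq> (0 :: complex)"
    using False by (simp add: d_def)
  have "(LINT x|torus. \<i> * of_real (of_int d) * cis (x * of_int d)) = 0"
    by (rule torus_integral_derivative_periodic[OF cis_frequency_has_vector_derivative])
       (auto intro!: continuous_intros)
  then have "(LINT x|torus. cis (x * of_int d)) = 0"
    using d by simp
  moreover have "cis (- (x * of_int n)) * cis (x * of_int k) = cis (x * of_int d)" for x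
    by (simp add: cis_mult d_def algebra_simps)
  ultimately show ?thesis
    using False by (simp add: fourier_coeff_def)
qed

lemma fourier_coeff_trig_sum:
  assumes "finite B"
  shows "fourier_coeff (\<lambda>x. \<Sum>k\<in>B. cis (x * of_int k) * c k) n = (if n \<in> B then c n else 0)"
proof -
  have int: "integrable torus (\<lambda>x. cis (- (x * of_int n)) * (cis (x * of_int k) * c k))" for k
    by (rule integrable_torus_bounded[of _ "norm (c k)"]) (auto simp: norm_mult)
  have "fourier_coeff (\<lambda>x. \<Sum>k\<in>B. cis (x * of_int k) * c k) n
      = (\<Sum>k\<in>B. LINT x|torus. cis (- (x * of_int n)) * (cis (x * of_int k) * c k))"
    unfolding fourier_coeff_def sum_distrib_left by (rule Bochner_Integration.integral_sum) (rule int)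
  also have "\<dots> = (\<Sum>k\<in>B. fourier_coeff (\<lambda>x. cis (x * of_int k)) n * c k)"
    by (simp add: fourier_coeff_def flip: mult.assoc)
  also have "\<dots> = (if n \<in> B then c n else 0)"
    using assms by (simp add: fourier_coeff_cis if_distrib[of "\<lambda>u. u * _"] cong: if_cong)
  finally show ?thesis .
qed

lemma norm_trig_sum_le: "norm (\<Sum>k\<in>B. cis (x * of_int k) * c k) \<le> (\<Sum>k\<in>B. norm (c k))"
  by (rule order_trans[OF norm_sum]) (simp add: norm_mult)

text \<open>
  Expanding only the conjugated factor turns the integral of \<open>cnj (P x) * P x\<close> into a combination of
  the Fourier coefficients of \<open>P\<close>, which are already known.
\<close>

lemma Parseval_trig_sum:
  assumes "finite B"
  shows "(LINT x|torus. (norm (\<Sum>k\<in>B. cis (x * of_int k) * c k))\<^sup>2) = (\<Sum>k\<in>B. (norm (c k))\<^sup>2)"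
proof -
  define P where "P x = (\<Sum>k\<in>B. cis (x * of_int k) * c k)" for x
  have [measurable]: "P \<in> borel_measurable borel"
    unfolding P_def by measurable
  have P_le: "norm (P x) \<le> (\<Sum>k\<in>B. norm (c k))" for x
    unfolding P_def by (rule norm_trig_sum_le)
  have int: "integrable torus (\<lambda>x. cnj (c k) * (cis (- (x * of_int k)) * P x))" for k
    by (rule integrable_torus_bounded[of _ "norm (c k) * (\<Sum>k\<in>B. norm (c k))"])
       (auto simp: norm_mult intro!: mult_left_mono P_le)
  have "complex_of_real (LINT x|torus. (norm (P x))\<^sup>2) = (LINT x|torus. cnj (P x) * P x)"
    by (simp flip: integral_complex_of_real complex_norm_square add: mult.commute)
  also have "\<dots> = (LINT x|torus. (\<Sum>k\<in>B. cnj (c k) * (cis (- (x * of_int k)) * P x)))"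
    by (subst (1) P_def) (simp add: sum_distrib_left sum_distrib_right cis_cnj mult_ac)
  also have "\<dots> = (\<Sum>k\<in>B. cnj (c k) * fourier_coeff P k)"
    unfolding fourier_coeff_def by (subst Bochner_Integration.integral_sum[OF int]) simp
  also have "\<dots> = (\<Sum>k\<in>B. cnj (c k) * c k)"
    unfolding P_def by (intro sum.cong refl) (simp add: fourier_coeff_trig_sum[OF assms])
  also have "\<dots> = complex_of_real (\<Sum>k\<in>B. (norm (c k))\<^sup>2)"
    by (simp add: mult.commute flip: complex_norm_square)
  finally show ?thesis
    unfolding P_def of_real_eq_iff .
qed

text \<open>
  The torus has total mass one, so the \<open>L\<^sup>2\<close> norm, which Parseval identifies with the \<open>\<ell>\<^sup>2\<close> norm of the
  coefficients, is at most the \<open>L\<^sup>\<infinity>\<close> norm.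
\<close>

lemma l2_norm_coeffs_le_Linf_norm:
  assumes "finite B"
  shows "ennreal (sqrt (\<Sum>k\<in>B. (norm (c k))\<^sup>2)) \<le> Linf_norm (\<lambda>x. \<Sum>k\<in>B. cis (x * of_int k) * c k)"
proof -
  define P where "P x = (\<Sum>k\<in>B. cis (x * of_int k) * c k)" for x
  have [measurable]: "P \<in> borel_measurable borel"
    unfolding P_def by measurable
  have P_le: "norm (P x) \<le> (\<Sum>k\<in>B. norm (c k))" for x
    unfolding P_def by (rule norm_trig_sum_le)
  have "ennreal (sqrt (\<Sum>k\<in>B. (norm (c k))\<^sup>2)) \<le> Linf_norm P"
  proof (cases "Linf_norm P")
    case top
    then show ?thesis by simp
  next
    case (real l)
    have "AE x in torus. ennreal (norm (P x)) \<le> ennreal l"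
      using esssup_AE[where M = torus and f = "\<lambda>x. ennreal (norm (P x))"] real by (simp add: Linf_norm_def)
    then have "AE x in torus. (norm (P x))\<^sup>2 \<le> l\<^sup>2"
      using real(1) by (auto simp: power_mono)
    moreover have "integrable torus (\<lambda>x. (norm (P x))\<^sup>2)"
      by (rule torus.integrable_const_bound[of _ "(\<Sum>k\<in>B. norm (c k))\<^sup>2"])
         (auto intro!: power_mono[OF P_le])
    ultimately have "(LINT x|torus. (norm (P x))\<^sup>2) \<le> (LINT x|torus. l\<^sup>2)"
      by (intro integral_mono_AE) auto
    then have "(\<Sum>k\<in>B. (norm (c k))\<^sup>2) \<le> l\<^sup>2"
      by (simp add: Parseval_trig_sum[OF assms] P_def torus.prob_space)
    then show ?thesis
      using real by (simp add: real_le_lsqrt ennreal_leI sum_nonneg)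
  qed
  then show ?thesis unfolding P_def .
qed

text \<open>
  The estimate for a single block: Cauchy--Schwarz against the constant sequence \<open>1\<close> on \<open>B\<close> produces
  the factor \<open>sqrt (card B)\<close>.
\<close>

lemma Linf_norm_multiplier_trig_sum_le:
  assumes "finite B" "0 \<le> M" and \<tau>: "\<And>k. k \<in> B \<Longrightarrow> norm (\<tau> k) \<le> M"
  shows "Linf_norm (\<lambda>x. \<Sum>k\<in>B. cis (x * of_int k) * (\<tau> k * c k))
    \<le> ennreal (M * sqrt (card B)) * Linf_norm (\<lambda>x. \<Sum>k\<in>B. cis (x * of_int k) * c k)"
proof -
  define S where "S = (\<Sum>k\<in>B. (norm (c k))\<^sup>2)"
  have "(\<Sum>k\<in>B. norm (\<tau> k * c k)) \<le> (\<Sum>k\<in>B. M * norm (c k))"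
    by (intro sum_mono) (auto simp: norm_mult intro!: mult_right_mono \<tau>)
  also have "\<dots> = M * (\<Sum>k\<in>B. norm (c k))"
    by (simp add: sum_distrib_left)
  also have "(\<Sum>k\<in>B. norm (c k)) \<le> sqrt (card B) * sqrt S"
    using Cauchy_Schwarz_ineq_sum[of "\<lambda>_. 1" "\<lambda>k. norm (c k)" B]
    by (simp add: S_def real_le_rsqrt flip: real_sqrt_mult)
  finally have le: "(\<Sum>k\<in>B. norm (\<tau> k * c k)) \<le> M * sqrt (card B) * sqrt S"
    using assms(2) by (simp add: mult_left_mono mult.assoc)
  have "Linf_norm (\<lambda>x. \<Sum>k\<in>B. cis (x * of_int k) * (\<tau> k * c k)) \<le> ennreal (M * sqrt (card B) * sqrt S)"
    unfolding Linf_norm_def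
    by (rule esssup_I) (use order_trans[OF norm_trig_sum_le le] in \<open>auto intro!: ennreal_leI\<close>)
  also have "\<dots> = ennreal (M * sqrt (card B)) * ennreal (sqrt S)"
    using assms(2) by (simp add: ennreal_mult S_def sum_nonneg)
  also have "\<dots> \<le> ennreal (M * sqrt (card B)) * Linf_norm (\<lambda>x. \<Sum>k\<in>B. cis (x * of_int k) * c k)"
    unfolding S_def by (intro mult_left_mono l2_norm_coeffs_le_Linf_norm assms) simp
  finally show ?thesis .
qed

section \<open>Fourier coefficients of a multiplier\<close>

lemma fourier_coeff_derivative:
  assumes deriv: "\<And>x. (f has_vector_derivative f' x) (at x)"
    and cont: "continuous_on UNIV f'"
    and periodic: "f (2 * pi) = f 0"
  shows "fourier_coeff f' n = \<i> * of_int n * fourier_coeff f n"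
proof -
  let ?e = "\<lambda>x. cis (- (x * of_int n))"
  have cont_f: "continuous_on UNIV f"
    using deriv by (intro continuous_at_imp_continuous_on ballI) (rule has_vector_derivative_continuous)
  have int: "integrable torus (\<lambda>x. ?e x * g x)" if g: "continuous_on UNIV g" for g :: "real \<Rightarrow> complex"
  proof -
    have [measurable]: "g \<in> borel_measurable borel"
      using g by (rule borel_measurable_continuous_onI)
    have "compact (g ` {0..2 * pi})"
      by (intro compact_continuous_image continuous_on_subset[OF g]) auto
    then obtain B where B: "\<forall>x\<in>{0..2 * pi}. norm (g x) \<le> B"
      by (auto dest!: compact_imp_bounded simp: bounded_iff)
    have "AE x in torus. x \<in> {0..<2 * pi}"
      unfolding torus_def by (rule AE_uniform_measureI) auto
    then show ?thesis
      by (intro torus.integrable_const_bound[of _ B]) (use B in \<open>auto simp: norm_mult\<close>)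
  qed
  have e': "(?e has_vector_derivative (- (\<i> * of_int n) * ?e x)) (at x)" for x
    using cis_frequency_has_vector_derivative[of "- of_int n" x] by simp
  have e_period: "cis (- (2 * pi * of_int n)) = 1"
    using cis_multiple_2pi[of "- of_int n"] by simp
  have "(LINT x|torus. ?e x * f' x + - (\<i> * of_int n) * ?e x * f x) = 0"
    by (rule torus_integral_derivative_periodic[OF has_vector_derivative_mult[OF e' deriv]])
       (use cont cont_f in \<open>auto intro!: continuous_intros simp: e_period periodic\<close>)
  moreover have "(LINT x|torus. ?e x * f' x + - (\<i> * of_int n) * ?e x * f x)
      = (LINT x|torus. ?e x * f' x) + (LINT x|torus. - (\<i> * of_int n) * (?e x * f x))"
    unfolding mult.assoc[of "- (\<i> * of_int n)"]
    by (intro Bochner_Integration.integral_add integrable_mult_right int cont cont_f)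
  ultimately show ?thesis
    by (simp add: fourier_coeff_def)
qed

lemma summable_inverse_squares_int: "(\<lambda>n::int. 1 / (of_int n)\<^sup>2 :: real) summable_on UNIV"
proof -
  have nat: "(\<lambda>n::nat. 1 / (real n)\<^sup>2) summable_on UNIV"
    using inverse_power_summable[of 2, where 'a = real]
    by (intro summable_nonneg_imp_summable_on) (auto simp: inverse_eq_divide)
  have A: "(\<lambda>n::int. 1 / (of_int n)\<^sup>2 :: real) summable_on range int"
    using nat by (subst summable_on_reindex) (auto simp: o_def)
  have B: "(\<lambda>n::int. 1 / (of_int n)\<^sup>2 :: real) summable_on range (\<lambda>n. - int n)"
    using nat by (subst summable_on_reindex) (auto simp: o_def inj_on_def)
  have "range int \<union> range (\<lambda>n. - int n) = UNIV"
    by (auto simp: image_iff) (metis int_cases2)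
  with summable_on_union[OF A B] show ?thesis by simp
qed

text \<open>
  Differentiating twice multiplies the coefficient of index \<open>n\<close> by \<open>- n\<^sup>2\<close>, while the coefficients of
  the second derivative stay bounded by its \<open>L\<^sup>1\<close> norm.
\<close>

lemma fourier_coeff_smooth_abs_summable:
  assumes "f \<in> smooth_torus"
  shows "(\<lambda>n. norm (fourier_coeff f n)) summable_on UNIV"
proof -
  from assms obtain D where per: "\<And>x. f (x + 2 * pi) = f x" and D0: "D 0 = f"
    and D: "\<And>n x. (D n has_vector_derivative D (Suc n) x) (at x)"
    by (auto simp: smooth_torus_def)
  have cont: "continuous_on UNIV (D n)" for n
    using D by (intro continuous_at_imp_continuous_on ballI) (rule has_vector_derivative_continuous)
  \<comment> \<open>The second integration by parts needs the endpoint values of the first derivative to agree: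
    differentiate \<open>f (x + 2 * pi) = f x\<close> at \<open>0\<close>.\<close>
  have shift: "((\<lambda>x. x + 2 * pi) has_vector_derivative 1) (at 0)"
    by (auto intro!: derivative_eq_intros)
  have "((\<lambda>x. f (x + 2 * pi)) has_vector_derivative D 1 (0 + 2 * pi)) (at 0)"
    using vector_diff_chain_at[of "\<lambda>x. x + 2 * pi" 1 0 f "D 1 (0 + 2 * pi)"] shift D[of 0 "0 + 2 * pi"] D0
    by (auto simp: o_def)
  then have per1: "D 1 (2 * pi) = D 1 0"
    using D[of 0 0] D0 by (auto simp: per dest: vector_derivative_unique_at)
  have coeff2: "fourier_coeff (D 2) n = - (of_int n)\<^sup>2 * fourier_coeff f n" for n
    using fourier_coeff_derivative[OF D[of 0] cont, of n] fourier_coeff_derivative[OF D[of 1] cont, of n]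
      per1 per[of 0] D0 by (simp add: power2_eq_square numeral_2_eq_2 algebra_simps)
  define B where "B = (LINT x|torus. norm (D 2 x))"
  have bound: "norm (fourier_coeff f n) \<le> B * (1 / (of_int n)\<^sup>2)" if "n \<noteq> 0" for n
  proof -
    have "norm (fourier_coeff (D 2) n) \<le> (LINT x|torus. norm (cis (- (x * of_int n)) * D 2 x))"
      unfolding fourier_coeff_def by (rule integral_norm_bound)
    then have "(of_int n)\<^sup>2 * norm (fourier_coeff f n) \<le> B"
      by (simp add: coeff2 norm_mult norm_power B_def)
    then show ?thesis
      using that by (simp add: field_simps)
  qed
  have "(\<lambda>n. norm (fourier_coeff f n)) summable_on (UNIV - {0})"
    by (rule summable_on_comparison_test[OF summable_on_cmult_right])
       (use bound in \<open>auto intro: summable_on_subset[OF summable_inverse_squares_int]\<close>)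
  from summable_on_union[OF this, of "{0}"] show ?thesis
    by simp
qed

lemma filterlim_symmetric_intervals:
  "filterlim (\<lambda>N. {- int N..int N}) (finite_subsets_at_top UNIV) sequentially"
  unfolding filterlim_finite_subsets_at_top
proof (intro allI impI)
  fix X :: "int set"
  assume X: "finite X \<and> X \<subseteq> UNIV"
  then obtain b where b: "\<And>x. x \<in> X \<Longrightarrow> nat \<bar>x\<bar> \<le> b"
    using finite_nat_set_iff_bounded_le[of "(\<lambda>x. nat \<bar>x\<bar>) ` X"] by auto
  show "\<forall>\<^sub>F N in sequentially. finite {- int N..int N} \<and> X \<subseteq> {- int N..int N} \<and> {- int N..int N} \<subseteq> UNIV"
    using eventually_ge_at_top[of b]
  proof eventually_elim
    case (elim N)
    have "x \<in> {- int N..int N}" if "x \<in> X" for x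
      using b[OF that] elim by auto
    then show ?case by auto
  qed
qed

text \<open>
  The partial sums over \<open>{- N..N}\<close> converge pointwise and are dominated by the constant
  \<open>\<Sum>\<^sub>\<infinity>k. norm (a k)\<close>, and their coefficient of index \<open>n\<close> equals \<open>a n\<close> as soon as \<open>N \<ge> \<bar>n\<bar>\<close>.
\<close>

lemma fourier_coeff_trig_series:
  assumes a: "(\<lambda>k. norm (a k)) summable_on UNIV"
  shows "fourier_coeff (\<lambda>x. \<Sum>\<^sub>\<infinity>k\<in>UNIV. cis (x * of_int k) * a k) n = a n"
proof -
  define g where "g x = (\<Sum>\<^sub>\<infinity>k\<in>UNIV. cis (x * of_int k) * a k)" for x
  define s where "s N x = (\<Sum>k\<in>{- int N..int N}. cis (x * of_int k) * a k)" for N x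
  have [measurable]: "s N \<in> borel_measurable borel" for N
    unfolding s_def by measurable
  have lim: "(\<lambda>N. s N x) \<longlonglongrightarrow> g x" for x
  proof -
    have "(\<lambda>k. norm (cis (x * of_int k) * a k)) summable_on UNIV"
      using a by (simp add: norm_mult)
    then have "((\<lambda>k. cis (x * of_int k) * a k) has_sum g x) UNIV"
      unfolding g_def by (rule has_sum_infsum[OF Infinite_Sum.abs_summable_summable])
    then show ?thesis
      unfolding has_sum_def s_def by (rule filterlim_compose[OF _ filterlim_symmetric_intervals])
  qed
  have [measurable]: "g \<in> borel_measurable borel"
    by (rule borel_measurable_LIMSEQ_metric[OF _ lim]) measurable
  have s_le: "norm (s N x) \<le> (\<Sum>\<^sub>\<infinity>k. norm (a k))" for N x
    unfolding s_def by (rule order_trans[OF norm_trig_sum_le finite_sum_le_infsum]) (use a in auto)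
  have "(\<lambda>N. fourier_coeff (s N) n) \<longlonglongrightarrow> fourier_coeff g n"
    unfolding fourier_coeff_def
    by (rule integral_dominated_convergence[where w = "\<lambda>_. \<Sum>\<^sub>\<infinity>k. norm (a k)"])
       (auto simp: norm_mult s_le intro!: tendsto_mult lim)
  moreover have "(\<lambda>N. fourier_coeff (s N) n) \<longlonglongrightarrow> a n"
  proof (rule tendsto_eventually)
    show "\<forall>\<^sub>F N in sequentially. fourier_coeff (s N) n = a n"
      using eventually_ge_at_top[of "nat \<bar>n\<bar>"]
    proof eventually_elim
      case (elim N)
      then have "n \<in> {- int N..int N}" by auto
      then show ?case by (simp add: s_def[abs_def] fourier_coeff_trig_sum)
    qed
  qed
  ultimately show ?thesis
    unfolding g_def by (rule LIMSEQ_unique)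
qed

lemma fourier_coeff_Op:
  assumes f: "f \<in> smooth_torus" and \<sigma>: "\<And>k. norm (\<sigma> k) \<le> A"
  shows "fourier_coeff (Op \<sigma> f) n = \<sigma> n * fourier_coeff f n"
proof -
  have "(\<lambda>k. norm (\<sigma> k * fourier_coeff f k)) summable_on UNIV"
    by (rule Infinite_Sum.abs_summable_on_comparison_test'
          [OF summable_on_cmult_right[OF fourier_coeff_smooth_abs_summable[OF f]]])
       (auto simp: norm_mult intro!: mult_right_mono \<sigma>)
  from fourier_coeff_trig_series[OF this, of n] show ?thesis
    by (simp add: Op_def[abs_def] mult.assoc)
qed

section \<open>The Besov estimate\<close>

lemma dyadic_frequencies:
  fixes m :: nat
  defines "B \<equiv> {\<xi>::int. 2 ^ m \<le> \<bar>\<xi>\<bar> \<and> \<bar>\<xi>\<bar> < 2 ^ (m + 1)}"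
  shows finite_dyadic_frequencies: "finite B"
    and card_dyadic_frequencies_le: "card B \<le> 2 * 2 ^ m"
proof -
  let ?I = "{2 ^ m..<2 ^ (m + 1)} :: int set"
  have sub: "B \<subseteq> ?I \<union> uminus ` ?I"
  proof
    fix x assume "x \<in> B"
    then show "x \<in> ?I \<union> uminus ` ?I"
      by (cases "0 \<le> x") (auto simp: B_def image_iff intro: bexI[of _ "- x"])
  qed
  then show "finite B"
    by (rule finite_subset) auto
  have card_I: "card ?I = 2 ^ m"
    by (simp add: nat_power_eq)
  have "card B \<le> card (?I \<union> uminus ` ?I)"
    using sub by (intro card_mono) auto
  also have "\<dots> \<le> card ?I + card (uminus ` ?I)"
    by (rule card_Un_le)
  also have "\<dots> \<le> card ?I + card ?I"
    by (intro add_left_mono card_image_le) auto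
  finally show "card B \<le> 2 * 2 ^ m"
    unfolding card_I by simp
qed

text \<open>
  On the block of index \<open>m\<close> the factors are \<open>2 powr (m * r)\<close> from the target weight,
  \<open>2 powr (- m * \<rho>)\<close> from the decay of \<open>\<sigma>\<close> and \<open>2 powr (m / 2)\<close> from the number of frequencies. Their
  product stays below the source weight \<open>2 powr (m * s)\<close> uniformly in \<open>m\<close> because
  \<open>r + 1 / 2 - \<rho> \<le> s\<close>.
\<close>

lemma Op_bounded_besov:
  assumes \<sigma>: "rho_condition \<rho> \<sigma>" and \<rho>: "0 \<le> \<rho>" and rs: "r + 1 / 2 \<le> s + \<rho>"
  shows "bounded_from_into (besov_norm s) (besov_norm r) (Op \<sigma>)"
proof -
  from \<sigma> obtain K where K: "K > 0"
    and \<sigma>_le: "\<And>\<xi>. \<xi> \<noteq> 0 \<Longrightarrow> norm (\<sigma> \<xi>) \<le> K * real_of_int \<bar>\<xi>\<bar> powr (- \<rho>)"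
    by (auto simp: rho_condition_def)
  have decay: "norm (\<sigma> \<xi>) \<le> K * 2 powr (- real m * \<rho>)" if "2 ^ m \<le> \<bar>\<xi>\<bar>" for \<xi> m
  proof -
    have "\<xi> \<noteq> 0"
      using that by auto
    moreover have "(2::real) ^ m \<le> real_of_int \<bar>\<xi>\<bar>"
      using that by (metis of_int_le_iff of_int_numeral of_int_power)
    then have "real_of_int \<bar>\<xi>\<bar> powr (- \<rho>) \<le> (2 ^ m) powr (- \<rho>)"
      using \<rho> by (intro powr_mono2') auto
    moreover have "((2::real) ^ m) powr (- \<rho>) = 2 powr (- real m * \<rho>)"
      by (simp add: powr_powr flip: powr_realpow)
    ultimately show ?thesis
      using \<sigma>_le[of \<xi>] K by (smt (verit) mult_left_mono)
  qed
  \<comment> \<open>The decay condition is silent at frequency zero, hence the separate term.\<close>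
  have bounded: "norm (\<sigma> \<xi>) \<le> max K (norm (\<sigma> 0))" for \<xi>
  proof (cases "\<xi> = 0")
    case False
    then have "1 \<le> \<bar>\<xi>\<bar>" by linarith
    then show ?thesis using decay[of 0 \<xi>] by simp
  qed simp
  have "besov_norm r (Op \<sigma> f) \<le> ennreal (K * sqrt 2) * besov_norm s f" if f: "f \<in> smooth_torus" for f
    unfolding besov_norm_def[of r]
  proof (rule SUP_least)
    fix m :: nat
    let ?B = "{\<xi>::int. 2 ^ m \<le> \<bar>\<xi>\<bar> \<and> \<bar>\<xi>\<bar> < 2 ^ (m + 1)}"
    let ?M = "K * 2 powr (- real m * \<rho>)"
    have "Linf_norm (dyadic_block m (Op \<sigma> f)) \<le> ennreal (?M * sqrt (card ?B)) * Linf_norm (dyadic_block m f)"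
      using Linf_norm_multiplier_trig_sum_le[OF finite_dyadic_frequencies[of m], of ?M \<sigma> "fourier_coeff f"] decay K
      by (simp add: dyadic_block_def[abs_def] fourier_coeff_Op[OF f bounded])
    then have "ennreal (2 powr (real m * r)) * Linf_norm (dyadic_block m (Op \<sigma> f))
        \<le> ennreal (2 powr (real m * r)) * (ennreal (?M * sqrt (card ?B)) * Linf_norm (dyadic_block m f))"
      by (rule mult_left_mono) simp
    also have "\<dots> = ennreal (2 powr (real m * r) * (?M * sqrt (card ?B))) * Linf_norm (dyadic_block m f)"
      using K by (simp add: ennreal_mult mult.assoc)
    also have "\<dots> \<le> ennreal (K * sqrt 2 * 2 powr (real m * s)) * Linf_norm (dyadic_block m f)"
    proof (intro mult_right_mono ennreal_leI)
      have exponent: "real m * (r + 1 / 2 - \<rho>) = real m * r + - real m * \<rho> + real m / 2"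
        by (simp add: algebra_simps)
      have "real (card ?B) \<le> real (2 * 2 ^ m)"
        using card_dyadic_frequencies_le[of m] by (simp only: of_nat_le_iff)
      also have "\<dots> = 2 * 2 powr real m"
        by (simp add: powr_realpow)
      also have "\<dots> = (sqrt 2 * 2 powr (real m / 2))\<^sup>2"
        by (simp add: power_mult_distrib powr_power)
      finally have "sqrt (card ?B) \<le> sqrt 2 * 2 powr (real m / 2)"
        by (intro real_le_lsqrt) auto
      then have "2 powr (real m * r) * (?M * sqrt (card ?B))
          \<le> 2 powr (real m * r) * (?M * (sqrt 2 * 2 powr (real m / 2)))"
        using K by (intro mult_left_mono) auto
      also have "\<dots> = K * sqrt 2 * 2 powr (real m * (r + 1 / 2 - \<rho>))"
        unfolding exponent powr_add by (simp only: mult_ac)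
      also have "\<dots> \<le> K * sqrt 2 * 2 powr (real m * s)"
        using K rs by (intro mult_left_mono powr_mono) auto
      finally show "2 powr (real m * r) * (?M * sqrt (card ?B)) \<le> K * sqrt 2 * 2 powr (real m * s)" .
    qed simp
    also have "\<dots> = ennreal (K * sqrt 2) * (ennreal (2 powr (real m * s)) * Linf_norm (dyadic_block m f))"
      using K by (simp add: ennreal_mult mult.assoc)
    also have "\<dots> \<le> ennreal (K * sqrt 2) * besov_norm s f"
      unfolding besov_norm_def by (intro mult_left_mono SUP_upper) auto
    finally show "ennreal (2 powr (real m * r)) * Linf_norm (dyadic_block m (Op \<sigma> f))
        \<le> ennreal (K * sqrt 2) * besov_norm s f" .
  qed
  moreover have "K * sqrt 2 > 0"
    using K by simp
  ultimately show ?thesis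
    unfolding bounded_from_into_def by blast
qed

theorem theorem3p13:
  fixes p r s \<rho> s\<^sub>p :: real and q :: ereal and \<sigma> :: "int \<Rightarrow> complex"
  assumes "2 / 3 < p" and "p \<le> 2"
    and "s\<^sub>p = 1 / p - 1 / 2"
    and "0 < r" and "r < 1"
    and "s\<^sub>p < s" and "s < 1"
    and "1 / q = ereal (1 - 1 / p)"
    and "\<rho> \<in> {0..1}"
    and "ereal r + 1 / q \<le> ereal \<rho>"
    and "rho_condition \<rho> \<sigma>"
  shows "bounded_from_into (besov_norm s) (besov_norm r) (Op \<sigma>)"
proof (rule Op_bounded_besov)
  show "rho_condition \<rho> \<sigma>" by fact
  show "0 \<le> \<rho>" using \<open>\<rho> \<in> {0..1}\<close> by simp
  \<comment> \<open>The term \<open>1 / q\<close> is the finite number \<open>1 - 1 / p\<close>, also for infinite \<open>q\<close> (\<open>p = 1\<close>) and for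
    negative \<open>q\<close> (\<open>p < 1\<close>).\<close>
  have "r + (1 - 1 / p) \<le> \<rho>"
    using assms(10) unfolding assms(8) by simp
  then show "r + 1 / 2 \<le> s + \<rho>"
    using assms(3,6) by linarith
qed

end
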